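(* Let $k\ge 1$ and let $\pi:\{1,\dots,k\}\to\{1,\dots,k\}$ be a permutation. Let $P$ be the 2-tuple matching determined by $\pi$, i.e. the ordered graph with vertex set $\{v_1<\dots<v_{3k}\}$ and edge set $\{v_jv_{k+i+2(\pi(j)-1)} : i\in\{1,2\},\ j\in\{1,\dots,k\}\}$. Then $ex_<(n,P)=O(n)$, where the implied constant depends only on $P$.
   Context: An ordered graph is a graph whose vertex set carries a fixed linear order. An ordered graph $G$ contains an ordered graph $P$ if there is an injective, order-preserving map $V(P)\to V(G)$ sending edges of $P$ to edges of $G$; otherwise $G$ avoids $P$. For an ordered graph $P$ with at least one edge, $ex_<(n,P)$ is the maximum number of edges of an ordered graph on $n$ vertices that avoids $P$. *)

theory Defs
  imports "HOL-Library.Landau_Symbols"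
begin

text \<open>The linear order of the vertices is the one of the ambient type.\<close>

type_synonym 'a ograph = "'a set \<times> 'a set set"

abbreviation verts :: "'a ograph \<Rightarrow> 'a set" where
  "verts \<equiv> fst"

abbreviation edges :: "'a ograph \<Rightarrow> 'a set set" where
  "edges \<equiv> snd"

definition ordered_graph :: "'a::linorder ograph \<Rightarrow> bool" where
  "ordered_graph G \<longleftrightarrow>
     finite (verts G) \<and> (\<forall>e\<in>edges G. e \<subseteq> verts G \<and> card e = 2)"

definition og_contains :: "'a::linorder ograph \<Rightarrow> 'b::linorder ograph \<Rightarrow> bool" where
  "og_contains G P \<longleftrightarrow>
     (\<exists>f. f ` verts P \<subseteq> verts G \<and> inj_on f (verts P) \<and> mono_on (verts P) f \<and>
          (\<forall>e\<in>edges P. f ` e \<in> edges G))"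

abbreviation og_avoids :: "'a::linorder ograph \<Rightarrow> 'b::linorder ograph \<Rightarrow> bool" where
  "og_avoids G P \<equiv> \<not> og_contains G P"

text \<open>Every ordered graph on \<open>n\<close> vertices is order-isomorphic to one whose vertices are natural
  numbers, so it suffices to let the host graphs range over these. The set under \<^const>\<open>Max\<close> is
  finite, and it is nonempty if \<open>P\<close> has an edge; see \<open>ex_ord_welldefined\<close> below.\<close>

definition ex_ord :: "nat \<Rightarrow> 'b::linorder ograph \<Rightarrow> nat" where
  "ex_ord n P =
     Max {card (edges G) |G :: nat ograph.
            ordered_graph G \<and> card (verts G) = n \<and> og_avoids G P}"

definition two_tuple_matching :: "nat \<Rightarrow> (nat \<Rightarrow> nat) \<Rightarrow> nat ograph" where
  "two_tuple_matching k \<pi> =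
     ({1..3 * k}, {{j, k + i + 2 * (\<pi> j - 1)} |i j. i \<in> {1, 2} \<and> j \<in> {1..k}})"

lemma ex_ord_welldefined:
  fixes P :: "'b::linorder ograph"
  assumes "edges P \<noteq> {}"
  defines "S \<equiv> \<lambda>n. {card (edges G) |G :: nat ograph.
                      ordered_graph G \<and> card (verts G) = n \<and> og_avoids G P}"
  shows "finite (S n)" "S n \<noteq> {}"
proof -
  have "S n \<subseteq> {..2 ^ n}"
  proof
    fix m assume "m \<in> S n"
    then obtain G :: "nat ograph" where G: "ordered_graph G" "card (verts G) = n"
      and m: "m = card (edges G)"
      by (auto simp: S_def)
    have "edges G \<subseteq> Pow (verts G)" and fin: "finite (verts G)"
      using G by (auto simp: ordered_graph_def)
    then have "m \<le> card (Pow (verts G))"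
      unfolding m by (intro card_mono) auto
    then show "m \<in> {..2 ^ n}"
      using G(2) fin by (simp add: card_Pow)
  qed
  then show "finite (S n)"
    by (rule finite_subset) simp
  let ?G = "({..<n}, {}) :: nat ograph"
  have "ordered_graph ?G" "card (verts ?G) = n" "og_avoids ?G P"
    using assms(1) by (auto simp: ordered_graph_def og_contains_def)
  then have "card (edges ?G) \<in> S n"
    unfolding S_def by blast
  then show "S n \<noteq> {}"
    by blast
qed

lemma ordered_graph_two_tuple_matching:
  assumes "bij_betw \<pi> {1..k} {1..k}"
  shows "ordered_graph (two_tuple_matching k \<pi>)"
proof -
  have "1 \<le> \<pi> j \<and> \<pi> j \<le> k" if "j \<in> {1..k}" for j
    using bij_betwE[OF assms] that by auto
  then show ?thesis
    by (fastforce simp: ordered_graph_def two_tuple_matching_def card_2_iff)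
qed

lemma edges_two_tuple_matching_nonempty:
  assumes "k \<ge> 1"
  shows "edges (two_tuple_matching k \<pi>) \<noteq> {}"
  using assms by (force simp: two_tuple_matching_def)

end

theory Submission
  imports Defs "HOL-Library.Infinite_Set"
begin

text \<open>
  The proof adapts the Marcus--Tardos argument. Read an ordered graph as a 0-1 matrix with all
  entries above the diagonal. Extending the pattern by one more row (the last one) whose two entries
  occupy the first two columns forces, in any occurrence, all rows to precede all columns; hence it
  suffices to bound the number of entries of a matrix that avoids a double permutation pattern.

  Cut the matrix into \<open>s \<times> s\<close> blocks. In each row of blocks, greedily merge consecutive blocks into
  chunks, closing a chunk as soon as some row has two entries in it. Record the first block of every
  chunk: between two recorded blocks of the same row of blocks there are two entries of a common
  row, so the contracted matrix avoids the same pattern. If every full \<open>k \<times> k\<close> grid contains the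
  pattern, then chunks meeting at least \<open>k\<close> rows (tall) or with more than \<open>k\<close> entries in a row
  (wide) are linear in number by pigeonhole, and all others have at most \<open>k\<^sup>2\<close> entries, which gives
  a recursion with a linear solution.
\<close>

section \<open>Finite sets\<close>

lemma ex_strict_mono_on_into:
  fixes I :: "'i::linorder set" and S :: "'a::wellorder set"
  assumes "finite I" "finite S" "card I \<le> card S"
  obtains e where "strict_mono_on I e" "e ` I \<subseteq> S"
proof
  define rank where "rank i = card {j\<in>I. j < i}" for i
  have rank_less: "rank i < rank j" if "i \<in> I" "i < j" for i j
    unfolding rank_def using assms(1) that by (intro psubset_card_mono) auto
  have rank_bound: "rank i < card S" if "i \<in> I" for i
    unfolding rank_def using that assms by (intro less_le_trans[OF psubset_card_mono]) auto
  show "strict_mono_on I (\<lambda>i. enumerate S (rank i))"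
    using assms(2) rank_less rank_bound by (auto intro!: strict_mono_onI finite_enumerate_mono)
  show "(\<lambda>i. enumerate S (rank i)) ` I \<subseteq> S"
    using assms(2) rank_bound by (auto intro: finite_enumerate_in_set)
qed

lemma card_le_card_image_mult:
  assumes "finite X" "\<And>x. x \<in> X \<Longrightarrow> card {x'\<in>X. f x' = f x} \<le> m"
  shows "card X \<le> card (f ` X) * m"
proof -
  have "card X = (\<Sum>y\<in>f ` X. card {x\<in>X. f x = y})"
    using sum.image_gen[OF assms(1), of "\<lambda>_. 1::nat" f] by simp
  also have "\<dots> \<le> card (f ` X) * m"
    using sum_bounded_above[of "f ` X" "\<lambda>y. card {x\<in>X. f x = y}" m] assms(2) by auto
  finally show ?thesis .
qed

lemma card_le_card_Domain_mult:
  assumes "finite R" "\<And>x. card (R `` {x}) \<le> m"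
  shows "card R \<le> card (Domain R) * m"
  unfolding Domain_fst
proof (rule card_le_card_image_mult[OF assms(1)])
  fix p
  have "{p'\<in>R. fst p' = fst p} = Pair (fst p) ` (R `` {fst p})"
    by auto
  then show "card {p'\<in>R. fst p' = fst p} \<le> m"
    using assms(2) by (simp add: card_image inj_on_def)
qed

section \<open>Double patterns\<close>

text \<open>The two entries of row \<open>i\<close> of the pattern occupy the column pair number \<open>\<sigma> i\<close>.\<close>

definition contains_double ::
    "'i::linorder set \<Rightarrow> ('i \<Rightarrow> nat) \<Rightarrow> ('a::linorder \<times> 'b::linorder) set \<Rightarrow> bool" where
  "contains_double I \<sigma> A \<longleftrightarrow>
     (\<exists>r a b. strict_mono_on I r \<and>
              (\<forall>i\<in>I. a i < b i \<and> (r i, a i) \<in> A \<and> (r i, b i) \<in> A) \<and>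
              (\<forall>i\<in>I. \<forall>j\<in>I. \<sigma> i < \<sigma> j \<longrightarrow> b i < a j))"

lemma contains_doubleI:
  assumes "strict_mono_on I r"
    and "\<And>i. i \<in> I \<Longrightarrow> a i < b i" "\<And>i. i \<in> I \<Longrightarrow> (r i, a i) \<in> A" "\<And>i. i \<in> I \<Longrightarrow> (r i, b i) \<in> A"
    and "\<And>i j. i \<in> I \<Longrightarrow> j \<in> I \<Longrightarrow> \<sigma> i < \<sigma> j \<Longrightarrow> b i < a j"
  shows "contains_double I \<sigma> A"
  unfolding contains_double_def using assms by blast

lemma contains_doubleE:
  assumes "contains_double I \<sigma> A"
  obtains r a b where "strict_mono_on I r"
    "\<And>i. i \<in> I \<Longrightarrow> a i < b i" "\<And>i. i \<in> I \<Longrightarrow> (r i, a i) \<in> A" "\<And>i. i \<in> I \<Longrightarrow> (r i, b i) \<in> A"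
    "\<And>i j. i \<in> I \<Longrightarrow> j \<in> I \<Longrightarrow> \<sigma> i < \<sigma> j \<Longrightarrow> b i < a j"
  using assms unfolding contains_double_def by (elim exE conjE) blast

lemma contains_double_mono:
  assumes "contains_double I \<sigma> A" "A \<subseteq> B"
  shows "contains_double I \<sigma> B"
  using assms unfolding contains_double_def by blast

lemma contains_double_lift:
  assumes "contains_double I \<sigma> B"
    and "A \<subseteq> X \<times> Y" "mono_on X \<phi>" "mono_on Y \<psi>"
    and lift: "\<And>R x y. (R, x) \<in> B \<Longrightarrow> (R, y) \<in> B \<Longrightarrow> x < y \<Longrightarrow>
      \<exists>r c d. (r, c) \<in> A \<and> (r, d) \<in> A \<and> c < d \<and> \<phi> r = R \<and> x \<le> \<psi> c \<and> \<psi> d \<le> y"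
  shows "contains_double I \<sigma> A"
proof -
  obtain R x y where R: "strict_mono_on I R"
    and xy: "\<And>i. i \<in> I \<Longrightarrow> x i < y i" "\<And>i. i \<in> I \<Longrightarrow> (R i, x i) \<in> B" "\<And>i. i \<in> I \<Longrightarrow> (R i, y i) \<in> B"
    and yx: "\<And>i j. i \<in> I \<Longrightarrow> j \<in> I \<Longrightarrow> \<sigma> i < \<sigma> j \<Longrightarrow> y i < x j"
    using assms(1) by (rule contains_doubleE) blast
  have "\<forall>i\<in>I. \<exists>r c d. (r, c) \<in> A \<and> (r, d) \<in> A \<and> c < d \<and> \<phi> r = R i \<and> x i \<le> \<psi> c \<and> \<psi> d \<le> y i"
    using lift xy by blast
  then obtain r c d where "\<forall>i\<in>I. (r i, c i) \<in> A \<and> (r i, d i) \<in> A \<and> c i < d i \<and>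
      \<phi> (r i) = R i \<and> x i \<le> \<psi> (c i) \<and> \<psi> (d i) \<le> y i"
    by metis
  then have mem: "\<And>i. i \<in> I \<Longrightarrow> (r i, c i) \<in> A" "\<And>i. i \<in> I \<Longrightarrow> (r i, d i) \<in> A"
    and "\<And>i. i \<in> I \<Longrightarrow> c i < d i"
    and \<phi>: "\<And>i. i \<in> I \<Longrightarrow> \<phi> (r i) = R i"
    and \<psi>: "\<And>i. i \<in> I \<Longrightarrow> x i \<le> \<psi> (c i)" "\<And>i. i \<in> I \<Longrightarrow> \<psi> (d i) \<le> y i"
    by auto
  have X: "r i \<in> X" and Y: "c i \<in> Y" "d i \<in> Y" if "i \<in> I" for i
    using mem[OF that] assms(2) by auto
  show ?thesis
  proof (rule contains_doubleI)
    show "strict_mono_on I r"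
    proof (rule strict_mono_onI)
      fix i j assume "i \<in> I" "j \<in> I" "i < j"
      then have "\<phi> (r i) < \<phi> (r j)"
        using strict_mono_onD[OF R] \<phi> by simp
      then show "r i < r j"
        using mono_on_strict_invE[OF assms(3)] X \<open>i \<in> I\<close> \<open>j \<in> I\<close> by blast
    qed
    fix i j assume "i \<in> I" "j \<in> I" "\<sigma> i < \<sigma> j"
    then have "\<psi> (d i) < \<psi> (c j)"
      using yx \<psi> by (meson le_less_trans less_le_trans)
    then show "d i < c j"
      using mono_on_strict_invE[OF assms(4)] Y \<open>i \<in> I\<close> \<open>j \<in> I\<close> by blast
  qed fact+
qed

lemma contains_double_map_prod:
  assumes "contains_double I \<sigma> (map_prod f g ` A)"
    and "A \<subseteq> X \<times> Y" "strict_mono_on X f" "strict_mono_on Y g"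
  shows "contains_double I \<sigma> A"
  using assms(1,2)
proof (rule contains_double_lift)
  show "mono_on X f" "mono_on Y g"
    using assms(3,4) by (simp_all add: strict_mono_on_imp_mono_on)
  fix R x y assume "(R, x) \<in> map_prod f g ` A" "(R, y) \<in> map_prod f g ` A" "x < y"
  then obtain r c r' d where mem: "(r, c) \<in> A" "(r', d) \<in> A"
    and eq: "R = f r" "R = f r'" "x = g c" "y = g d"
    by auto
  then have "r \<in> X" "r' \<in> X" "c \<in> Y" "d \<in> Y"
    using assms(2) by auto
  then have "r' = r" "c < d"
    using strict_mono_on_eq[OF assms(3)] strict_mono_on_less[OF assms(4)] eq \<open>x < y\<close> by auto
  then show "\<exists>r c d. (r, c) \<in> A \<and> (r, d) \<in> A \<and> c < d \<and> f r = R \<and> x \<le> g c \<and> g d \<le> y"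
    using mem eq by blast
qed

definition grid_threshold :: "'i::linorder set \<Rightarrow> ('i \<Rightarrow> nat) \<Rightarrow> nat \<Rightarrow> bool" where
  "grid_threshold I \<sigma> k \<longleftrightarrow>
     (\<forall>(S :: nat set) (T :: nat set). finite S \<longrightarrow> finite T \<longrightarrow> k \<le> card S \<longrightarrow> k \<le> card T \<longrightarrow>
        contains_double I \<sigma> (S \<times> T))"

lemma grid_thresholdI:
  assumes "finite I" "\<And>i. i \<in> I \<Longrightarrow> \<sigma> i < m" "card I \<le> k" "2 * m \<le> k"
  shows "grid_threshold I \<sigma> k"
  unfolding grid_threshold_def
proof (intro allI impI)
  fix S T :: "nat set"
  assume S: "finite S" "k \<le> card S" and T: "finite T" "k \<le> card T"
  obtain r where r: "strict_mono_on I r" "r ` I \<subseteq> S"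
    using ex_strict_mono_on_into[OF assms(1) S(1)] S(2) assms(3) by auto
  obtain e where e: "strict_mono_on {..<2 * m} e" "e ` {..<2 * m} \<subseteq> T"
    using ex_strict_mono_on_into[OF finite_lessThan T(1), of "2 * m"] T(2) assms(4) by auto
  show "contains_double I \<sigma> (S \<times> T)"
  proof (rule contains_doubleI[OF r(1)])
    fix i assume i: "i \<in> I"
    then show "e (2 * \<sigma> i) < e (2 * \<sigma> i + 1)"
      using assms(2)[OF i] by (intro strict_mono_onD[OF e(1)]) auto
    show "(r i, e (2 * \<sigma> i)) \<in> S \<times> T" "(r i, e (2 * \<sigma> i + 1)) \<in> S \<times> T"
      using assms(2)[OF i] i r(2) e(2) by auto
    fix j assume "j \<in> I" "\<sigma> i < \<sigma> j"
    then show "e (2 * \<sigma> i + 1) < e (2 * \<sigma> j)"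
      using assms(2)[of j] by (intro strict_mono_onD[OF e(1)]) auto
  qed
qed

lemma ex_grid_threshold:
  assumes "finite I"
  obtains k where "k > 0" "grid_threshold I \<sigma> k"
proof -
  obtain m where "\<And>i. i \<in> I \<Longrightarrow> \<sigma> i < m"
    using assms finite_nat_set_iff_bounded[of "\<sigma> ` I"] by auto
  then have "grid_threshold I \<sigma> (Suc (card I + 2 * m))"
    using assms by (intro grid_thresholdI) auto
  then show thesis
    by (rule that[OF zero_less_Suc])
qed

section \<open>Contracting a matrix\<close>

definition block :: "nat \<Rightarrow> nat \<Rightarrow> nat set" where
  "block s q = {x. x div s = q}"

lemma block_eq_interval: "s > 0 \<Longrightarrow> block s q = {q * s..<q * s + s}"
  by (auto simp: block_def div_nat_eqI algebra_simps dividend_less_times_div)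

lemma finite_block: "s > 0 \<Longrightarrow> finite (block s q)"
  by (simp add: block_eq_interval)

lemma card_block: "s > 0 \<Longrightarrow> card (block s q) = s"
  by (simp add: block_eq_interval)

definition has_row_pair :: "nat \<Rightarrow> (nat \<times> nat) set \<Rightarrow> nat \<Rightarrow> nat \<Rightarrow> nat \<Rightarrow> bool" where
  "has_row_pair s A q t u \<longleftrightarrow>
     (\<exists>r c d. (r, c) \<in> A \<and> (r, d) \<in> A \<and> r div s = q \<and> c < d \<and> t \<le> c div s \<and> d div s < u)"

lemma has_row_pair_mono: "has_row_pair s A q t u \<Longrightarrow> t' \<le> t \<Longrightarrow> has_row_pair s A q t' u"
  unfolding has_row_pair_def by (blast intro: le_trans)

primrec chunk_start :: "nat \<Rightarrow> (nat \<times> nat) set \<Rightarrow> nat \<Rightarrow> nat \<Rightarrow> nat" where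
  "chunk_start s A q 0 = 0"
| "chunk_start s A q (Suc t) =
     (if has_row_pair s A q (chunk_start s A q t) (Suc t) then Suc t else chunk_start s A q t)"

lemma chunk_start_le: "chunk_start s A q t \<le> t"
  by (induction t) (auto simp: le_SucI)

lemma mono_chunk_start: "mono (chunk_start s A q)"
  by (simp add: mono_iff_le_Suc le_SucI chunk_start_le)

lemma has_row_pair_chunk_start:
  assumes "chunk_start s A q t < chunk_start s A q u"
  shows "has_row_pair s A q (chunk_start s A q t) (chunk_start s A q u)"
  using assms
proof (induction u)
  case (Suc u)
  show ?case
  proof (cases "has_row_pair s A q (chunk_start s A q u) (Suc u)")
    case True
    have "t \<le> u"
      by (rule mono_strict_invE[OF mono_chunk_start Suc.prems]) simp
    then show ?thesis
      using has_row_pair_mono[OF True monoD[OF mono_chunk_start]] True by simp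
  next
    case False
    then show ?thesis
      using Suc by simp
  qed
qed simp

definition contract :: "nat \<Rightarrow> (nat \<times> nat) set \<Rightarrow> nat \<times> nat \<Rightarrow> nat \<times> nat" where
  "contract s A = (\<lambda>(r, c). (r div s, chunk_start s A (r div s) (c div s)))"

lemma contract_image_subset:
  assumes "A \<subseteq> {..<N * s} \<times> {..<N * s}"
  shows "contract s A ` A \<subseteq> {..<N} \<times> {..<N}"
proof -
  have "r div s < N" "chunk_start s A (r div s) (c div s) < N" if "(r, c) \<in> A" for r c
  proof -
    have "r < N * s" "c < N * s"
      using that assms by auto
    then have "r div s < N" "c div s < N"
      by (simp_all add: less_mult_imp_div_less)
    then show "r div s < N" "chunk_start s A (r div s) (c div s) < N"
      using chunk_start_le le_less_trans by blast+
  qed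
  then show ?thesis
    by (auto simp: contract_def)
qed

lemma contains_double_contract:
  assumes "contains_double I \<sigma> (contract s A ` A)"
  shows "contains_double I \<sigma> A"
  using assms
proof (rule contains_double_lift)
  show "mono_on UNIV (\<lambda>x. x div s)" "mono_on UNIV (\<lambda>x. x div s)"
    by (intro monoI div_le_mono; assumption)+
  fix R x y assume "(R, x) \<in> contract s A ` A" "(R, y) \<in> contract s A ` A" "x < y"
  then have "has_row_pair s A R x y"
    using has_row_pair_chunk_start by (auto simp: contract_def)
  then show "\<exists>r c d. (r, c) \<in> A \<and> (r, d) \<in> A \<and> c < d \<and> r div s = R \<and> x \<le> c div s \<and> d div s \<le> y"
    unfolding has_row_pair_def using less_imp_le by blast
qed auto

section \<open>Chunks\<close>

definition chunk :: "nat \<Rightarrow> (nat \<times> nat) set \<Rightarrow> nat \<times> nat \<Rightarrow> (nat \<times> nat) set" where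
  "chunk s A b = {x\<in>A. contract s A x = b}"

lemma chunk_subset: "chunk s A b \<subseteq> A"
  by (auto simp: chunk_def)

lemma mem_chunk_iff:
  "(r, c) \<in> chunk s A (q, t) \<longleftrightarrow> (r, c) \<in> A \<and> r div s = q \<and> chunk_start s A q (c div s) = t"
  by (auto simp: chunk_def contract_def)

lemma finite_chunk: "finite A \<Longrightarrow> finite (chunk s A b)"
  by (simp add: chunk_def)

lemma finite_chunk_row: "finite A \<Longrightarrow> finite (chunk s A b `` {r})"
  by (simp add: finite_chunk finite_Image)

lemma Domain_chunk_subset: "Domain (chunk s A b) \<subseteq> block s (fst b)"
  by (cases b) (auto simp: mem_chunk_iff block_def)

text \<open>If \<open>c2\<close> and \<open>c3\<close> were in different blocks, the pair \<open>c1\<close>, \<open>c2\<close> would have closed the chunk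
  before the block of \<open>c3\<close>.\<close>

lemma chunk_row_same_block:
  assumes "(r, c1) \<in> chunk s A b" "(r, c2) \<in> chunk s A b" "(r, c3) \<in> chunk s A b"
    and "c1 < c2" "c2 \<le> c3"
  shows "c2 div s = c3 div s"
proof (rule ccontr)
  obtain q t where b: "b = (q, t)"
    by fastforce
  note mem = assms(1-3)[unfolded b mem_chunk_iff]
  assume "c2 div s \<noteq> c3 div s"
  then have "Suc (c2 div s) \<le> c3 div s"
    using assms(5) div_le_mono[of c2 c3 s] by simp
  then have "chunk_start s A q (Suc (c2 div s)) \<le> t"
    using mem(3) monoD[OF mono_chunk_start] by blast
  moreover have "t \<le> c1 div s"
    using mem(1) chunk_start_le by blast
  then have "has_row_pair s A q t (Suc (c2 div s))"
    unfolding has_row_pair_def using mem assms(4) by blast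
  then have "chunk_start s A q (Suc (c2 div s)) = Suc (c2 div s)"
    using mem(2) by simp
  moreover have "t \<le> c2 div s"
    using mem(2) chunk_start_le by blast
  ultimately show False
    by simp
qed

lemma card_chunk_row_le_block:
  assumes "finite A"
  obtains t where "card (chunk s A b `` {r}) \<le> Suc (card (chunk s A b `` {r} \<inter> block s t))"
proof -
  define C where "C = chunk s A b `` {r}"
  have fin: "finite C"
    unfolding C_def using assms by (rule finite_chunk_row)
  have "C - {Min C} \<subseteq> C \<inter> block s (Max C div s)"
  proof
    fix c assume c: "c \<in> C - {Min C}"
    then have "C \<noteq> {}"
      by blast
    then have "Min C \<in> C" "Max C \<in> C" "Min C < c" "c \<le> Max C"
      using c fin by (auto simp: less_le)
    then show "c \<in> C \<inter> block s (Max C div s)"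
      using c chunk_row_same_block[of r "Min C" s A b c "Max C"] by (simp add: C_def block_def)
  qed
  then have "card (C - {Min C}) \<le> card (C \<inter> block s (Max C div s))"
    using fin by (intro card_mono) auto
  then have "card C \<le> Suc (card (C \<inter> block s (Max C div s)))"
    using diff_card_le_card_Diff[of "{Min C}" C] by simp
  then show thesis
    unfolding C_def by (rule that)
qed

lemma card_chunk_le:
  assumes "finite A" "s > 0"
  shows "card (chunk s A b) \<le> s * (s + 1)"
proof -
  have "card (chunk s A b `` {r}) \<le> s + 1" for r
  proof -
    obtain t where "card (chunk s A b `` {r}) \<le> Suc (card (chunk s A b `` {r} \<inter> block s t))"
      using assms(1) by (rule card_chunk_row_le_block)
    also have "card (chunk s A b `` {r} \<inter> block s t) \<le> s"
      using card_mono[OF finite_block[OF assms(2)] Int_lower2] by (simp add: card_block assms(2))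
    finally show ?thesis
      by simp
  qed
  then have "card (chunk s A b) \<le> card (Domain (chunk s A b)) * (s + 1)"
    using assms(1) by (intro card_le_card_Domain_mult finite_chunk)
  moreover have "card (Domain (chunk s A b)) \<le> s"
    using card_mono[OF finite_block[OF assms(2)] Domain_chunk_subset]
    by (simp add: card_block assms(2))
  ultimately show ?thesis
    by (meson le_trans mult_le_mono1)
qed

section \<open>Counting tall and wide chunks\<close>

definition tall_chunks :: "nat \<Rightarrow> nat \<Rightarrow> (nat \<times> nat) set \<Rightarrow> (nat \<times> nat) set" where
  "tall_chunks k s A = {b \<in> contract s A ` A. k \<le> card (Domain (chunk s A b))}"

definition wide_chunks :: "nat \<Rightarrow> nat \<Rightarrow> (nat \<times> nat) set \<Rightarrow> (nat \<times> nat) set" where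
  "wide_chunks k s A = {b \<in> contract s A ` A. \<exists>r. k < card (chunk s A b `` {r})}"

lemma finite_tall_chunks: "finite A \<Longrightarrow> finite (tall_chunks k s A)"
  by (simp add: tall_chunks_def)

lemma finite_wide_chunks: "finite A \<Longrightarrow> finite (wide_chunks k s A)"
  by (simp add: wide_chunks_def)

lemma card_chunk_le_square:
  assumes "finite A" "b \<in> contract s A ` A - (tall_chunks k s A \<union> wide_chunks k s A)"
  shows "card (chunk s A b) \<le> k\<^sup>2"
proof -
  have "card (Domain (chunk s A b)) \<le> k" "\<And>r. card (chunk s A b `` {r}) \<le> k"
    using assms(2) by (auto simp: tall_chunks_def wide_chunks_def not_less not_le)
  then show ?thesis
    unfolding power2_eq_square using card_le_card_Domain_mult[OF finite_chunk[OF assms(1)]]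
    by (meson le_trans mult_le_mono1)
qed

lemma card_le_block_subsets:
  assumes "finite X" "s > 0"
    and "f ` X \<subseteq> (SIGMA q:{..<N}. Pow (block s q))"
    and "\<And>x. x \<in> X \<Longrightarrow> card {x'\<in>X. f x' = f x} \<le> m"
  shows "card X \<le> N * 2 ^ s * m"
proof -
  have "card (SIGMA q:{..<N}. Pow (block s q)) = N * 2 ^ s"
    using assms(2) by (simp add: card_SigmaI card_Pow finite_block card_block)
  moreover have "finite (SIGMA q:{..<N}. Pow (block s q))"
    using assms(2) by (simp add: finite_block)
  ultimately have "card (f ` X) \<le> N * 2 ^ s"
    using assms(3) card_mono by metis
  then have "card (f ` X) * m \<le> N * 2 ^ s * m"
    by (rule mult_le_mono1)
  then show ?thesis
    using card_le_card_image_mult[OF assms(1,4)] by (rule le_trans[rotated])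
qed

lemma card_chunks_sharing_rows_le:
  assumes "grid_threshold I \<sigma> k" "\<not> contains_double I \<sigma> A"
    and "finite S" "finite T" "k \<le> card S"
    and rows: "\<And>t. t \<in> T \<Longrightarrow> S \<subseteq> Domain (chunk s A (q, t))"
  shows "card T \<le> k"
proof (rule ccontr)
  assume "\<not> card T \<le> k"
  then have "contains_double I \<sigma> (S \<times> T)"
    using assms(1,3-5) by (simp add: grid_threshold_def)
  then have "contains_double I \<sigma> A"
  proof (rule contains_double_lift)
    let ?\<psi> = "\<lambda>c. chunk_start s A q (c div s)"
    show "mono_on UNIV (\<lambda>r::nat. r)"
      by (rule monoI)
    show mono: "mono_on UNIV ?\<psi>"
      by (intro monoI monoD[OF mono_chunk_start] div_le_mono)
    fix r t u assume "(r, t) \<in> S \<times> T" "(r, u) \<in> S \<times> T" "t < u"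
    then obtain c d where "(r, c) \<in> chunk s A (q, t)" "(r, d) \<in> chunk s A (q, u)"
      using rows by blast
    then have cd: "(r, c) \<in> A" "(r, d) \<in> A" "?\<psi> c = t" "?\<psi> d = u"
      by (simp_all add: mem_chunk_iff)
    moreover have "c < d"
      using mono_strict_invE[OF mono] cd(3,4) \<open>t < u\<close> by blast
    ultimately show "\<exists>r' c d. (r', c) \<in> A \<and> (r', d) \<in> A \<and> c < d \<and> r' = r \<and> t \<le> ?\<psi> c \<and> ?\<psi> d \<le> u"
      by blast
  qed auto
  with assms(2) show False ..
qed

lemma card_tall_chunks:
  assumes "finite A" "contract s A ` A \<subseteq> {..<N} \<times> {..<N}" "s > 0"
    and "grid_threshold I \<sigma> k" "\<not> contains_double I \<sigma> A"
  shows "card (tall_chunks k s A) \<le> N * 2 ^ s * k"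
proof (rule card_le_block_subsets[where f = "\<lambda>b. (fst b, Domain (chunk s A b))"])
  show "(\<lambda>b. (fst b, Domain (chunk s A b))) ` tall_chunks k s A
          \<subseteq> (SIGMA q:{..<N}. Pow (block s q))"
    using assms(2) Domain_chunk_subset by (fastforce simp: tall_chunks_def)
next
  fix b assume "b \<in> tall_chunks k s A"
  then have "k \<le> card (Domain (chunk s A b))"
    by (simp add: tall_chunks_def)
  define X where
    "X = {x \<in> tall_chunks k s A. (fst x, Domain (chunk s A x)) = (fst b, Domain (chunk s A b))}"
  have X: "fst x = fst b" "Domain (chunk s A x) = Domain (chunk s A b)" if "x \<in> X" for x
    using that by (simp_all add: X_def)
  have "inj_on snd X"
    using X(1) by (auto simp: inj_on_def prod_eq_iff)
  then have "card X = card (snd ` X)"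
    by (simp add: card_image)
  also have "\<dots> \<le> k"
  proof (rule card_chunks_sharing_rows_le[OF assms(4,5)])
    show "finite (Domain (chunk s A b))"
      using assms(1) by (simp add: finite_Domain finite_chunk)
    show "finite (snd ` X)"
      using finite_tall_chunks[OF assms(1)] by (simp add: X_def)
    show "Domain (chunk s A b) \<subseteq> Domain (chunk s A (fst b, t))" if "t \<in> snd ` X" for t
      using that X by force
  qed fact
  finally show "card {x \<in> tall_chunks k s A.
      (fst x, Domain (chunk s A x)) = (fst b, Domain (chunk s A b))} \<le> k"
    by (simp add: X_def)
qed (use assms finite_tall_chunks in auto)

lemma wide_chunkE:
  assumes "A \<subseteq> {..<N * s} \<times> {..<N * s}" "k > 0" "b \<in> wide_chunks k s A"
  obtains r t L where "t < N" "L \<subseteq> block s t" "k \<le> card L" "{r} \<times> L \<subseteq> A"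
    "(r div s, chunk_start s A (r div s) t) = b"
proof -
  have finA: "finite A"
    using assms(1) finite_subset by blast
  obtain r where r: "k < card (chunk s A b `` {r})"
    using assms(3) by (auto simp: wide_chunks_def)
  obtain t where "card (chunk s A b `` {r}) \<le> Suc (card (chunk s A b `` {r} \<inter> block s t))"
    using finA by (rule card_chunk_row_le_block)
  moreover define L where "L = chunk s A b `` {r} \<inter> block s t"
  ultimately have "k \<le> card L"
    using r by simp
  then obtain c where c: "c \<in> L"
    using assms(2) by fastforce
  then have "(r, c) \<in> A" "c div s = t"
    using chunk_subset[of s A b] by (auto simp: L_def block_def)
  then have "t < N"
    using assms(1) less_mult_imp_div_less by blast
  moreover have "L \<subseteq> block s t" "{r} \<times> L \<subseteq> A"
    using chunk_subset[of s A b] by (auto simp: L_def)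
  moreover have "(r div s, chunk_start s A (r div s) t) = b"
    using c by (cases b) (auto simp: L_def block_def mem_chunk_iff)
  ultimately show thesis
    using that \<open>k \<le> card L\<close> by blast
qed

lemma card_rows_sharing_columns_le:
  fixes A :: "(nat \<times> nat) set"
  assumes "grid_threshold I \<sigma> k" "\<not> contains_double I \<sigma> A"
    and "finite R" "finite L" "k \<le> card L" "R \<times> L \<subseteq> A"
  shows "card R \<le> k"
proof (rule ccontr)
  assume "\<not> card R \<le> k"
  then have "contains_double I \<sigma> (R \<times> L)"
    using assms(1,3-5) by (simp add: grid_threshold_def)
  then show False
    using assms(2,6) contains_double_mono by blast
qed

lemma card_wide_chunks:
  assumes "A \<subseteq> {..<N * s} \<times> {..<N * s}" "s > 0" "k > 0"
    and "grid_threshold I \<sigma> k" "\<not> contains_double I \<sigma> A"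
  shows "card (wide_chunks k s A) \<le> N * 2 ^ s * k"
proof -
  let ?W = "wide_chunks k s A"
  have finW: "finite ?W"
    using assms(1) finite_subset finite_wide_chunks by blast
  have "\<forall>b\<in>?W. \<exists>r t L. t < N \<and> L \<subseteq> block s t \<and> k \<le> card L \<and> {r} \<times> L \<subseteq> A \<and>
      (r div s, chunk_start s A (r div s) t) = b"
    using wide_chunkE[OF assms(1,3)] by metis
  then obtain r t L where "\<forall>b\<in>?W. t b < N \<and> L b \<subseteq> block s (t b) \<and> k \<le> card (L b) \<and>
      {r b} \<times> L b \<subseteq> A \<and> (r b div s, chunk_start s A (r b div s) (t b)) = b"
    by metis
  then have t: "t b < N" and L: "L b \<subseteq> block s (t b)" "k \<le> card (L b)" "{r b} \<times> L b \<subseteq> A"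
    and chunk_eq: "(r b div s, chunk_start s A (r b div s) (t b)) = b" if "b \<in> ?W" for b
    using that by simp_all
  show ?thesis
  proof (rule card_le_block_subsets[OF finW assms(2), where f = "\<lambda>b. (t b, L b)"])
    show "(\<lambda>b. (t b, L b)) ` ?W \<subseteq> (SIGMA q:{..<N}. Pow (block s q))"
      by (intro image_subsetI SigmaI PowI L(1)) (simp_all add: t)
    fix b assume "b \<in> ?W"
    define X where "X = {x \<in> ?W. (t x, L x) = (t b, L b)}"
    have X: "x \<in> ?W" "t x = t b" "L x = L b" if "x \<in> X" for x
      using that by (simp_all add: X_def)
    have "inj_on r X"
    proof (rule inj_on_inverseI)
      show "(r x div s, chunk_start s A (r x div s) (t b)) = x" if "x \<in> X" for x
        using chunk_eq[OF X(1)[OF that]] unfolding X(2)[OF that] .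
    qed
    then have "card X = card (r ` X)"
      by (simp add: card_image)
    also have "\<dots> \<le> k"
    proof (rule card_rows_sharing_columns_le[OF assms(4,5)])
      show "finite (r ` X)"
        using finW by (simp add: X_def)
      show "finite (L b)"
        using L(1)[OF \<open>b \<in> ?W\<close>] finite_block[OF assms(2)] by (rule finite_subset)
      show "k \<le> card (L b)"
        using L(2)[OF \<open>b \<in> ?W\<close>] .
      show "r ` X \<times> L b \<subseteq> A"
        using L(3)[OF X(1)] X(3) by blast
    qed
    finally show "card {x \<in> ?W. (t x, L x) = (t b, L b)} \<le> k"
      by (simp add: X_def)
  qed
qed

section \<open>The linear bound for matrices\<close>

definition large_chunk_entries :: "nat \<Rightarrow> nat \<Rightarrow> nat" where
  "large_chunk_entries k s = 2 ^ s * (2 * k) * (s * (s + 1))"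

lemma card_le_contract:
  assumes "A \<subseteq> {..<N * s} \<times> {..<N * s}" "s > 0" "k > 0"
    and "grid_threshold I \<sigma> k" "\<not> contains_double I \<sigma> A"
  shows "card A \<le> N * large_chunk_entries k s + card (contract s A ` A) * k\<^sup>2"
proof -
  define B where "B = contract s A ` A"
  define D where "D = tall_chunks k s A \<union> wide_chunks k s A"
  have finA: "finite A"
    using assms(1) finite_subset by blast
  then have fin: "finite B" "finite D"
    by (simp_all add: B_def D_def finite_tall_chunks finite_wide_chunks)
  have "D \<subseteq> B"
    by (auto simp: B_def D_def tall_chunks_def wide_chunks_def)
  have "card A = (\<Sum>b\<in>B. card (chunk s A b))"
    unfolding B_def chunk_def using sum.image_gen[OF finA, of "\<lambda>_. 1::nat" "contract s A"] by simp
  also have "\<dots> = (\<Sum>b\<in>D. card (chunk s A b)) + (\<Sum>b\<in>B - D. card (chunk s A b))"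
    using \<open>D \<subseteq> B\<close> fin by (simp add: sum.subset_diff add.commute)
  also have "(\<Sum>b\<in>D. card (chunk s A b)) \<le> card D * (s * (s + 1))"
    using sum_bounded_above[of D "\<lambda>b. card (chunk s A b)"] card_chunk_le[OF finA assms(2)] by simp
  also have "card D \<le> N * (2 ^ s * (2 * k))"
    using card_Un_le[of "tall_chunks k s A" "wide_chunks k s A"] card_wide_chunks[OF assms]
      card_tall_chunks[OF finA contract_image_subset[OF assms(1)] assms(2,4,5)]
    unfolding D_def by (simp add: algebra_simps)
  also have "(\<Sum>b\<in>B - D. card (chunk s A b)) \<le> card (B - D) * k\<^sup>2"
    using sum_bounded_above[of "B - D" "\<lambda>b. card (chunk s A b)" "k\<^sup>2"] card_chunk_le_square[OF finA]
    by (simp add: B_def D_def)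
  also have "card (B - D) \<le> card B"
    using fin by (intro card_mono) auto
  finally show ?thesis
    by (simp add: B_def large_chunk_entries_def mult.assoc)
qed

lemma contraction_recursion_bound:
  fixes k :: nat
  assumes "k > 0" "s = 4 * k\<^sup>2" "N * s \<le> 2 * n" "K \<le> C" "m \<le> N * K + C * N * k\<^sup>2"
  shows "m \<le> C * n"
proof -
  have "C \<le> k\<^sup>2 * C"
    using assms(1) by simp
  then have K: "K + k\<^sup>2 * C \<le> 2 * k\<^sup>2 * C"
    using assms(4) by linarith
  have "s * m \<le> s * (N * K + C * N * k\<^sup>2)"
    using assms(5) by (rule mult_le_mono2)
  also have "\<dots> = (N * s) * (K + k\<^sup>2 * C)"
    by (simp add: algebra_simps)
  also have "\<dots> \<le> (2 * n) * (2 * k\<^sup>2 * C)"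
    using assms(3) K by (rule mult_le_mono)
  also have "\<dots> = s * (C * n)"
    by (simp add: assms(2))
  finally show ?thesis
    using assms(1,2) by simp
qed

lemma block_countE:
  fixes s n :: nat
  assumes "s > 2" "s \<le> n"
  obtains N where "n \<le> N * s" "N * s \<le> 2 * n" "N < n"
proof
  let ?N = "n div s + 1"
  have "?N * s = n div s * s + s"
    by simp
  then show "n \<le> ?N * s" and le: "?N * s \<le> 2 * n"
    using assms dividend_less_div_times[of s n] div_times_less_eq_dividend[of n s] by linarith+
  have "?N * 3 \<le> ?N * s"
    using assms(1) by (intro mult_le_mono2) simp
  then show "?N < n"
    using le assms by simp
qed

lemma avoids_double_linear_step:
  assumes "k > 0" "grid_threshold I \<sigma> k" "s = 4 * k\<^sup>2" "s \<le> n" "large_chunk_entries k s \<le> C"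
    and A: "A \<subseteq> {..<n} \<times> {..<n}" "\<not> contains_double I \<sigma> A"
    and IH: "\<And>N B. N < n \<Longrightarrow> B \<subseteq> {..<N} \<times> {..<N} \<Longrightarrow> \<not> contains_double I \<sigma> B \<Longrightarrow> card B \<le> C * N"
  shows "card A \<le> C * n"
proof -
  have "k\<^sup>2 > 0"
    using assms(1) by simp
  then have s: "s > 2" "s > 0"
    unfolding assms(3) by linarith+
  from s(1) assms(4) obtain N where N: "n \<le> N * s" "N * s \<le> 2 * n" "N < n"
    by (rule block_countE)
  have sub: "A \<subseteq> {..<N * s} \<times> {..<N * s}"
    using A(1) N(1) by fastforce
  have "card (contract s A ` A) \<le> C * N"
    using IH[OF N(3) contract_image_subset[OF sub]] A(2) contains_double_contract by blast
  moreover have "card A \<le> N * large_chunk_entries k s + card (contract s A ` A) * k\<^sup>2"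
    using sub s(2) assms(1,2) A(2) by (rule card_le_contract)
  ultimately have "card A \<le> N * large_chunk_entries k s + C * N * k\<^sup>2"
    by (meson add_left_mono le_trans mult_le_mono1)
  then show ?thesis
    by (rule contraction_recursion_bound[OF assms(1,3) N(2) assms(5)])
qed

lemma avoids_double_linear_nat:
  assumes "finite I"
  obtains C where
    "\<And>n A. A \<subseteq> {..<n} \<times> {..<n} \<Longrightarrow> \<not> contains_double I \<sigma> A \<Longrightarrow> card A \<le> C * n"
proof -
  obtain k where k: "k > 0" "grid_threshold I \<sigma> k"
    using assms by (rule ex_grid_threshold)
  define s where "s = 4 * k\<^sup>2"
  define C where "C = large_chunk_entries k s + s"
  have "card A \<le> C * n" if "A \<subseteq> {..<n} \<times> {..<n}" "\<not> contains_double I \<sigma> A" for n A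
    using that
  proof (induction n arbitrary: A rule: less_induct)
    case (less n)
    show ?case
    proof (cases "s \<le> n")
      case True
      show ?thesis
        by (rule avoids_double_linear_step[OF k s_def True _ less.prems less.IH])
          (simp_all add: C_def)
    next
      case False
      have "card A \<le> n * n"
        using card_mono[OF _ less.prems(1)] by simp
      also have "\<dots> \<le> C * n"
        using False by (simp add: C_def)
      finally show ?thesis .
    qed
  qed
  then show thesis
    by (rule that)
qed

theorem avoids_double_linear:
  assumes "finite I"
  obtains C where
    "\<And>(V :: 'a::linorder set) A. finite V \<Longrightarrow> A \<subseteq> V \<times> V \<Longrightarrow> \<not> contains_double I \<sigma> A \<Longrightarrow>
       card A \<le> C * card V"
proof -
  obtain C where
    C: "\<And>n A. A \<subseteq> {..<n} \<times> {..<n} \<Longrightarrow> \<not> contains_double I \<sigma> A \<Longrightarrow> card A \<le> C * n"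
    using assms by (rule avoids_double_linear_nat[of I \<sigma>]) blast
  have "card A \<le> C * card V"
    if V: "finite V" "A \<subseteq> V \<times> V" and avoid: "\<not> contains_double I \<sigma> A" for V :: "'a set" and A
  proof -
    obtain f where f: "strict_mono_on V f" "f ` V \<subseteq> {..<card V}"
      using ex_strict_mono_on_into[of V "{..<card V}"] V(1) by auto
    then have "inj_on f V"
      by (intro strict_mono_on_imp_inj_on)
    then have "inj_on (map_prod f f) A"
      by (intro inj_on_subset[OF map_prod_inj_on V(2)])
    then have "card A = card (map_prod f f ` A)"
      by (simp add: card_image)
    also have "\<dots> \<le> C * card V"
    proof (rule C)
      show "map_prod f f ` A \<subseteq> {..<card V} \<times> {..<card V}"
        using V(2) f(2) by fastforce
      show "\<not> contains_double I \<sigma> (map_prod f f ` A)"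
        using avoid contains_double_map_prod[OF _ V(2) f(1) f(1)] by blast
    qed
    finally show ?thesis .
  qed
  then show thesis
    by (rule that)
qed

section \<open>From matrices to ordered graphs\<close>

definition forward_edges :: "'a::linorder ograph \<Rightarrow> ('a \<times> 'a) set" where
  "forward_edges G = {(x, y). x < y \<and> {x, y} \<in> edges G}"

lemma forward_edges_subset: "ordered_graph G \<Longrightarrow> forward_edges G \<subseteq> verts G \<times> verts G"
  by (auto simp: forward_edges_def ordered_graph_def)

lemma card_forward_edges:
  assumes "ordered_graph G"
  shows "card (forward_edges G) = card (edges G)"
proof (rule bij_betw_same_card[of "\<lambda>(x, y). {x, y}"], rule bij_betw_imageI)
  show "inj_on (\<lambda>(x, y). {x, y}) (forward_edges G)"
    by (auto simp: inj_on_def forward_edges_def doubleton_eq_iff)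
  show "(\<lambda>(x, y). {x, y}) ` forward_edges G = edges G"
  proof
    show "edges G \<subseteq> (\<lambda>(x, y). {x, y}) ` forward_edges G"
    proof
      fix e assume e: "e \<in> edges G"
      then obtain x y where "e = {x, y}" "x \<noteq> y"
        using assms by (auto simp: ordered_graph_def card_2_iff)
      then obtain x y where "e = {x, y}" "x < y"
        by (metis insert_commute linorder_neqE)
      then show "e \<in> (\<lambda>(x, y). {x, y}) ` forward_edges G"
        using e by (auto simp: forward_edges_def)
    qed
  qed (auto simp: forward_edges_def)
qed

lemma og_contains_if_strict_mono_on:
  assumes "ordered_graph G" "strict_mono_on (verts P) f"
    and "verts P \<subseteq> \<Union> (edges P)" "\<And>e. e \<in> edges P \<Longrightarrow> f ` e \<in> edges G"
  shows "og_contains G P"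
  unfolding og_contains_def
proof (intro exI conjI ballI)
  have "\<Union> (edges G) \<subseteq> verts G"
    using assms(1) by (auto simp: ordered_graph_def)
  then show "f ` verts P \<subseteq> verts G"
    using assms(3,4) by blast
  show "inj_on f (verts P)"
    using assms(2) by (rule strict_mono_on_imp_inj_on)
  show "mono_on (verts P) f"
    using assms(2) by (rule strict_mono_on_imp_mono_on)
qed (use assms(4) in blast)

definition interleave :: "(nat \<Rightarrow> 'a) \<Rightarrow> (nat \<Rightarrow> 'a) \<Rightarrow> nat \<Rightarrow> 'a" where
  "interleave a b x = (if odd x then a else b) (Suc x div 2)"

lemma interleave_even: "interleave a b (2 * p) = b p"
  by (simp add: interleave_def)

lemma interleave_odd: "interleave a b (Suc (2 * p)) = a (Suc p)"
  by (simp add: interleave_def)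

lemma strict_mono_on_interleave:
  fixes a b :: "nat \<Rightarrow> 'a::linorder"
  assumes ab: "\<And>p. p \<in> {1..m} \<Longrightarrow> a p < b p"
    and ba: "\<And>p q. p \<in> {1..m} \<Longrightarrow> q \<in> {1..m} \<Longrightarrow> p < q \<Longrightarrow> b p < a q"
  shows "strict_mono_on {1..2 * m} (interleave a b)"
proof (rule strict_mono_onI)
  fix x y assume "x \<in> {1..2 * m}" "y \<in> {1..2 * m}" "x < y"
  define p q where "p = Suc x div 2" and "q = Suc y div 2"
  have pq: "p \<in> {1..m}" "q \<in> {1..m}" "p \<le> q"
    using \<open>x \<in> _\<close> \<open>y \<in> _\<close> \<open>x < y\<close> by (auto simp: p_def q_def div_le_mono)
  show "interleave a b x < interleave a b y"
  proof (cases "p = q")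
    case True
    then have "y = Suc x"
      using \<open>x < y\<close> unfolding p_def q_def by linarith
    then have "odd x" "even y"
      using True by (auto simp: p_def q_def)
    then show ?thesis
      using ab[OF pq(1)] True by (simp add: interleave_def p_def q_def)
  next
    case False
    have "interleave a b x \<le> b p"
      using ab[OF pq(1)] by (auto simp: interleave_def p_def)
    also have "\<dots> < a q"
      using False pq by (intro ba) auto
    also have "\<dots> \<le> interleave a b y"
      using ab[OF pq(2)] by (auto simp: interleave_def q_def)
    finally show ?thesis .
  qed
qed

lemma strict_mono_on_append:
  fixes r c :: "nat \<Rightarrow> 'a::order"
  assumes "strict_mono_on {1..k} r" "strict_mono_on {1..m} c"
    and "\<And>i j. i \<in> {1..k} \<Longrightarrow> j \<in> {1..m} \<Longrightarrow> r i < c j"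
  shows "strict_mono_on {1..k + m} (\<lambda>v. if v \<le> k then r v else c (v - k))"
proof (rule strict_mono_onI)
  fix v w assume vw: "v \<in> {1..k + m}" "w \<in> {1..k + m}" "v < w"
  consider (left) "w \<le> k" | (across) "v \<le> k" "k < w" | (right) "k < v"
    by linarith
  then show "(if v \<le> k then r v else c (v - k)) < (if w \<le> k then r w else c (w - k))"
  proof cases
    case left
    then show ?thesis
      using vw by (auto intro: strict_mono_onD[OF assms(1)])
  next
    case across
    then show ?thesis
      using vw by (auto intro!: assms(3))
  next
    case right
    then show ?thesis
      using vw by (auto intro!: strict_mono_onD[OF assms(2)])
  qed
qed

lemma verts_two_tuple_matching_subset:
  assumes "bij_betw \<pi> {1..k} {1..k}"
  shows "verts (two_tuple_matching k \<pi>) \<subseteq> \<Union> (edges (two_tuple_matching k \<pi>))"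
proof
  fix v assume "v \<in> verts (two_tuple_matching k \<pi>)"
  then have v: "v \<in> {1..3 * k}"
    by (simp add: two_tuple_matching_def)
  have "\<exists>i j. v \<in> {j, k + i + 2 * (\<pi> j - 1)} \<and> i \<in> {1, 2} \<and> j \<in> {1..k}"
  proof (cases "v \<le> k")
    case True
    with v show ?thesis
      by (intro exI[of _ 1] exI[of _ v]) auto
  next
    case False
    define w where "w = v - Suc k"
    have w: "v = Suc (k + w)"
      using False by (simp add: w_def)
    define p where "p = Suc (w div 2)"
    have "p \<in> {1..k}"
      using v w by (auto simp: p_def)
    then obtain j where j: "j \<in> {1..k}" "\<pi> j = p"
      using assms by (metis bij_betw_iff_bijections)
    have "v = k + 1 + 2 * (p - 1) \<or> v = k + 2 + 2 * (p - 1)"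
      by (cases "even w") (auto simp: w p_def elim!: evenE oddE)
    then show ?thesis
      using j by blast
  qed
  then obtain i j where ij: "i \<in> {1, 2}" "j \<in> {1..k}" and v: "v \<in> {j, k + i + 2 * (\<pi> j - 1)}"
    by blast
  have "{j, k + i + 2 * (\<pi> j - 1)} \<in> edges (two_tuple_matching k \<pi>)"
    unfolding two_tuple_matching_def snd_conv using ij by blast
  with v show "v \<in> \<Union> (edges (two_tuple_matching k \<pi>))"
    by (rule UnionI[rotated])
qed

lemma og_contains_two_tuple_matchingI:
  assumes G: "ordered_graph G" and \<pi>: "bij_betw \<pi> {1..k} {1..k}"
    and r: "strict_mono_on {1..k} r" and ra: "\<And>i j. i \<in> {1..k} \<Longrightarrow> j \<in> {1..k} \<Longrightarrow> r i < a j"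
    and ab: "\<And>j. j \<in> {1..k} \<Longrightarrow> a j < b j"
    and ba: "\<And>i j. i \<in> {1..k} \<Longrightarrow> j \<in> {1..k} \<Longrightarrow> \<pi> i < \<pi> j \<Longrightarrow> b i < a j"
    and edges: "\<And>j. j \<in> {1..k} \<Longrightarrow> {r j, a j} \<in> edges G" "\<And>j. j \<in> {1..k} \<Longrightarrow> {r j, b j} \<in> edges G"
  shows "og_contains G (two_tuple_matching k \<pi>)"
proof -
  define \<tau> where "\<tau> = inv_into {1..k} \<pi>"
  have \<tau>: "\<tau> p \<in> {1..k}" "\<pi> (\<tau> p) = p" if "p \<in> {1..k}" for p
    using that \<pi> bij_betw_inv_into[OF \<pi>] unfolding \<tau>_def
    by (metis bij_betwE, metis bij_betw_inv_into_right)
  have \<pi>j: "\<pi> j \<in> {1..k}" "\<tau> (\<pi> j) = j" if "j \<in> {1..k}" for j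
    using that \<pi> unfolding \<tau>_def by (metis bij_betwE, metis bij_betw_inv_into_left)
  define c where "c = interleave (a \<circ> \<tau>) (b \<circ> \<tau>)"
  define f where "f v = (if v \<le> k then r v else c (v - k))" for v
  show ?thesis
  proof (rule og_contains_if_strict_mono_on[OF G _ verts_two_tuple_matching_subset[OF \<pi>]])
    have "strict_mono_on {1..2 * k} c"
      unfolding c_def using \<tau> ab ba by (intro strict_mono_on_interleave) auto
    moreover have "r i < c x" if "i \<in> {1..k}" "x \<in> {1..2 * k}" for i x
    proof -
      have "\<tau> (Suc x div 2) \<in> {1..k}"
        using that(2) by (intro \<tau>) auto
      then show ?thesis
        using ra[OF that(1)] ab by (force simp: c_def interleave_def intro: less_trans)
    qed
    ultimately have "strict_mono_on {1..k + 2 * k} f"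
      unfolding f_def using r by (intro strict_mono_on_append)
    then show "strict_mono_on (verts (two_tuple_matching k \<pi>)) f"
      by (simp add: two_tuple_matching_def)
  next
    fix e assume "e \<in> edges (two_tuple_matching k \<pi>)"
    then obtain i j where ij: "i \<in> {1, 2}" "j \<in> {1..k}" "e = {j, k + i + 2 * (\<pi> j - 1)}"
      by (auto simp: two_tuple_matching_def)
    obtain p where p: "\<pi> j = Suc p"
      using \<pi>j(1)[OF ij(2)] by (cases "\<pi> j") auto
    have "f (k + 1 + 2 * (\<pi> j - 1)) = a j" "f (k + 2 + 2 * (\<pi> j - 1)) = b j"
      using \<pi>j(2)[OF ij(2)] interleave_odd[of "a \<circ> \<tau>" "b \<circ> \<tau>" p]
        interleave_even[of "a \<circ> \<tau>" "b \<circ> \<tau>" "Suc p"]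
      by (simp_all add: f_def c_def p)
    moreover have "f j = r j"
      using ij(2) by (simp add: f_def)
    ultimately show "f ` e \<in> edges G"
      using ij edges by auto
  qed
qed

text \<open>Since \<open>\<pi>\<close> is positive, the value \<open>0\<close> assigns the first pair of columns to the
  additional last row.\<close>

lemma og_contains_if_forward_edges_contain_double:
  assumes G: "ordered_graph G" and \<pi>: "bij_betw \<pi> {1..k} {1..k}"
    and "contains_double {1..Suc k} (\<pi>(Suc k := 0)) (forward_edges G)"
  shows "og_contains G (two_tuple_matching k \<pi>)"
proof -
  obtain r a b where r: "strict_mono_on {1..Suc k} r"
    and ab: "\<And>i. i \<in> {1..Suc k} \<Longrightarrow> a i < b i"
    and mem: "\<And>i. i \<in> {1..Suc k} \<Longrightarrow> (r i, a i) \<in> forward_edges G"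
      "\<And>i. i \<in> {1..Suc k} \<Longrightarrow> (r i, b i) \<in> forward_edges G"
    and ba: "\<And>i j. i \<in> {1..Suc k} \<Longrightarrow> j \<in> {1..Suc k} \<Longrightarrow>
      (\<pi>(Suc k := 0)) i < (\<pi>(Suc k := 0)) j \<Longrightarrow> b i < a j"
    using assms(3) by (rule contains_doubleE) blast
  show ?thesis
  proof (rule og_contains_two_tuple_matchingI[OF G \<pi>])
    show "strict_mono_on {1..k} r"
      using r by (rule monotone_on_subset) auto
    fix i j assume i: "i \<in> {1..k}" and j: "j \<in> {1..k}"
    have "r i < r (Suc k)"
      using i by (intro strict_mono_onD[OF r]) auto
    also have "\<dots> < a (Suc k)"
      using mem(1)[of "Suc k"] by (simp add: forward_edges_def)
    also have "\<dots> < b (Suc k)"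
      by (simp add: ab)
    also have "\<dots> < a j"
      using j bij_betwE[OF \<pi>, rule_format, OF j] by (intro ba) auto
    finally show "r i < a j" .
    show "b i < a j" if "\<pi> i < \<pi> j"
      using that i j by (intro ba) auto
  qed (use ab mem in \<open>auto simp: forward_edges_def\<close>)
qed

theorem theorem3p1:
  fixes k :: nat and \<pi> :: "nat \<Rightarrow> nat"
  assumes "k \<ge> 1"
    and "bij_betw \<pi> {1..k} {1..k}"
  shows "(\<lambda>n. real (ex_ord n (two_tuple_matching k \<pi>))) \<in> O(\<lambda>n. real n)"
proof -
  let ?P = "two_tuple_matching k \<pi>"
  obtain C where C: "\<And>(V :: nat set) A. finite V \<Longrightarrow> A \<subseteq> V \<times> V \<Longrightarrow>
      \<not> contains_double {1..Suc k} (\<pi>(Suc k := 0)) A \<Longrightarrow> card A \<le> C * card V"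
    by (rule avoids_double_linear[OF finite_atLeastAtMost]) blast
  have "card (edges G) \<le> C * card (verts G)"
    if G: "ordered_graph G" and avoid: "og_avoids G ?P" for G :: "nat ograph"
  proof -
    have "finite (verts G)"
      using G by (simp add: ordered_graph_def)
    then have "card (forward_edges G) \<le> C * card (verts G)"
      using C forward_edges_subset[OF G] avoid
        og_contains_if_forward_edges_contain_double[OF G assms(2)] by blast
    then show ?thesis
      by (simp add: card_forward_edges[OF G])
  qed
  then have "ex_ord n ?P \<le> C * n" for n
    unfolding ex_ord_def
    using Max_le_iff[OF ex_ord_welldefined[OF edges_two_tuple_matching_nonempty[OF assms(1)]]]
    by blast
  then have "real (ex_ord n ?P) \<le> real C * real n" for n
    by (metis of_nat_le_iff of_nat_mult)
  then show ?thesis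
    by (intro bigoI[of _ "real C"]) simp
qed

end
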